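(* Let $(F_n)_{n\in\mathbb{Z}}$ be the Fibonacci numbers and $(G_n)_{n\in\mathbb{Z}}$ a Fibonacci-like sequence. Let $a,b,m,n$ be integers and $k$ a non-negative integer. Each of the following six identities holds whenever the denominators occurring in its summand are nonzero for all $0\le j\le k$: \[ (-1)^{a+b+1}F_{m-a}G_nG_{n-(m-a)(k+1)}\sum_{j=0}^k\frac{F_{a-b}^{k-j}F_{m-b}^{j}G_{n-m+b-(m-a)k+(m-a)j}}{G_{n-(m-a)k+(m-a)j}\,G_{n-(m-a)-(m-a)k+(m-a)j}}=F_{a-b}^{k+1}G_n-F_{m-b}^{k+1}G_{n-(m-a)(k+1)}, \] \[ F_{m-b}G_nG_{n-(m-b)(k+1)}\sum_{j=0}^k\frac{(-1)^{(a+b+1)j}F_{a-b}^{k-j}F_{m-a}^{j}G_{n-(m-a)-(m-b)k+(m-b)j}}{G_{n-(m-b)k+(m-b)j}\,G_{n-(m-b)-(m-b)k+(m-b)j}}=F_{a-b}^{k+1}G_n-(-1)^{(a+b+1)(k+1)}F_{m-a}^{k+1}G_{n-(m-b)(k+1)}, \] \[ F_{a-b}G_nG_{n-(a-b)(k+1)}\sum_{j=0}^k\frac{(-1)^{(a+b)j}F_{m-b}^{k-j}F_{m-a}^{j}G_{n+m-a-(a-b)k+(a-b)j}}{G_{n-(a-b)k+(a-b)j}\,G_{n-(a-b)-(a-b)k+(a-b)j}}=F_{m-b}^{k+1}G_n-(-1)^{(a+b)(k+1)}F_{m-a}^{k+1}G_{n-(a-b)(k+1)}, \] \[ (-1)^{a+b+1}F_{m+b}G_nG_{n-(m+b)(k+1)}\sum_{j=0}^k\frac{F_{a-b}^{k-j}F_{m+a}^{j}G_{n-m-a-(m+b)k+(m+b)j}}{G_{n-(m+b)k+(m+b)j}\,G_{n-(m+b)-(m+b)k+(m+b)j}}=F_{a-b}^{k+1}G_n-F_{m+a}^{k+1}G_{n-(m+b)(k+1)},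 \] \[ F_{m+a}G_nG_{n-(m+a)(k+1)}\sum_{j=0}^k\frac{(-1)^{(a+b+1)j}F_{a-b}^{k-j}F_{m+b}^{j}G_{n-(m+b)-(m+a)k+(m+a)j}}{G_{n-(m+a)k+(m+a)j}\,G_{n-(m+a)-(m+a)k+(m+a)j}}=F_{a-b}^{k+1}G_n-(-1)^{(a+b+1)(k+1)}F_{m+b}^{k+1}G_{n-(m+a)(k+1)}, \] \[ F_{a-b}G_nG_{n-(a-b)(k+1)}\sum_{j=0}^k\frac{(-1)^{(a+b)j}F_{m+a}^{k-j}F_{m+b}^{j}G_{n+m+b-(a-b)k+(a-b)j}}{G_{n-(a-b)k+(a-b)j}\,G_{n-(a-b)-(a-b)k+(a-b)j}}=F_{m+a}^{k+1}G_n-(-1)^{(a+b)(k+1)}F_{m+b}^{k+1}G_{n-(a-b)(k+1)}. \]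
   Context: The Fibonacci numbers are defined by $F_0=0$, $F_1=1$, $F_n=F_{n-1}+F_{n-2}$ for $n\ge 2$, and $F_{-n}=(-1)^{n-1}F_n$. A Fibonacci-like sequence $(G_n)_{n\in\mathbb{Z}}$ is defined by arbitrary integers $G_0,G_1$, not both zero, with $G_n=G_{n-1}+G_{n-2}$ for $n\ge 2$, extended to negative indices by $G_{-n}=G_{-n+2}-G_{-n+1}$. The convention $0^0=1$ is used for powers. *)

theory Defs
  imports Complex_Main "HOL-Number_Theory.Fib"
begin

text \<open>Extension of the library's Fibonacci numbers to all integer indices
  by $F_{-n} = (-1)^{n-1} F_n$ for $n \ge 1$.\<close>

definition fibz :: "int \<Rightarrow> int" where
  "fibz n = (if n \<ge> 0 then int (fib (nat n))
             else (- 1) ^ nat (- n - 1) * int (fib (nat (- n))))"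

definition fib_like :: "(int \<Rightarrow> int) \<Rightarrow> bool" where
  "fib_like G \<longleftrightarrow>
     (G 0 \<noteq> 0 \<or> G 1 \<noteq> 0) \<and>
     (\<forall>n\<ge>2. G n = G (n - 1) + G (n - 2)) \<and>
     (\<forall>n\<ge>1. G (- n) = G (- n + 2) - G (- n + 1))"

end

theory Submission
  imports Defs
begin

text \<open>All six summands telescope. Put \<open>p = a - b\<close>. The two cases \<open>q = m - a\<close>
  (so \<open>p + q = m - b\<close>) and \<open>q = m + b\<close> (so \<open>p + q = m + a\<close>) turn every identity into a
  rearrangement of
  \<open>F\<^sub>p\<^sub>+\<^sub>q G\<^sub>y = F\<^sub>p G\<^sub>y\<^sub>+\<^sub>q + (-1)\<^sup>p F\<^sub>q G\<^sub>y\<^sub>-\<^sub>p\<close>.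
  This relation expresses \<open>C H\<^sub>x\<close>, the prefactor times the \<open>G\<close>-term in the numerator, as
  \<open>A G\<^sub>x - B G\<^sub>x\<^sub>-\<^sub>d\<close>, so that the sum collapses. Both sides of the relation satisfy the
  Fibonacci recurrence in \<open>p\<close> and in \<open>q\<close>, so it suffices to check it for \<open>p, q \<in> {0, 1}\<close>.\<close>

definition fib_rec :: "(int \<Rightarrow> 'a::ring_1) \<Rightarrow> bool" where
  "fib_rec g \<longleftrightarrow> (\<forall>i. g (i + 2) = g (i + 1) + g i)"

lemma fib_recD: "fib_rec g \<Longrightarrow> g (i + 2) = g (i + 1) + g i"
  by (simp add: fib_rec_def)

lemma fib_rec_eq_zero:
  assumes g: "fib_rec g" and "g 0 = 0" "g 1 = 0"
  shows "g i = 0"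
proof -
  have "g i = 0 \<and> g (i + 1) = 0"
  proof (induction i rule: int_induct[where k = 0])
    case base
    then show ?case using assms by simp
  next
    case (step1 i)
    then show ?case using fib_recD[OF g, of i] by (simp add: add.assoc)
  next
    case (step2 i)
    then show ?case using fib_recD[OF g, of "i - 1"] by (simp add: algebra_simps)
  qed
  then show ?thesis ..
qed

lemma fib_rec_eqI:
  assumes "fib_rec f" "fib_rec g" "f 0 = g 0" "f 1 = g 1"
  shows "f i = g i"
proof -
  have "fib_rec (\<lambda>i. f i - g i)"
    using assms(1,2) by (simp add: fib_rec_def)
  from fib_rec_eq_zero[OF this] show ?thesis
    using assms(3,4) by simp
qed

lemma fibz_0 [simp]: "fibz 0 = 0"
  and fibz_1 [simp]: "fibz 1 = 1"
  by (simp_all add: fibz_def)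

lemma fib_rec_fibz: "fib_rec fibz"
  unfolding fib_rec_def
proof
  fix i :: int
  consider (nonneg) j where "i = int j" | (m1) "i = -1" | (neg) j where "i = - int (j + 2)"
  proof -
    have "i = int (nat i)" if "0 \<le> i"
      using that by simp
    moreover have "i = - int (nat (- i - 2) + 2)" if "i < 0" "i \<noteq> -1"
      using that by simp
    ultimately show ?thesis
      using that by (metis not_less)
  qed
  then show "fibz (i + 2) = fibz (i + 1) + fibz i"
  proof cases
    case nonneg
    then show ?thesis by (simp add: fibz_def nat_add_distrib)
  next
    case m1
    then show ?thesis by (simp add: fibz_def)
  next
    case neg
    have "fibz (- int l) = - ((- 1) ^ l * int (fib l))" for l
      by (cases l) (simp_all add: fibz_def nat_add_distrib)
    then have "fibz (- int j) = fibz (- int (Suc j)) + fibz (- int (Suc (Suc j)))"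
      by (simp del: of_nat_Suc add: algebra_simps)
    moreover have "i + 2 = - int j" "i + 1 = - int (Suc j)" "i = - int (Suc (Suc j))"
      using neg by simp_all
    ultimately show ?thesis by metis
  qed
qed

lemma fib_rec_fib_like:
  assumes "fib_like G"
  shows "fib_rec G"
  unfolding fib_rec_def
proof
  fix i :: int
  show "G (i + 2) = G (i + 1) + G i"
  proof (cases "0 \<le> i")
    case True
    then have "G (i + 2) = G (i + 2 - 1) + G (i + 2 - 2)"
      using assms unfolding fib_like_def by (metis add.commute le_add_same_cancel1)
    then show ?thesis by (simp add: add.commute)
  next
    case False
    then have "1 \<le> - i" by simp
    then have "G (- (- i)) = G (- (- i) + 2) - G (- (- i) + 1)"
      using assms unfolding fib_like_def by blast
    then show ?thesis by simp
  qed
qed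

lemma fib_rec_of_int: "fib_rec g \<Longrightarrow> fib_rec (\<lambda>i. of_int (g i))"
  by (simp add: fib_rec_def)

lemma fib_rec_scale: "fib_rec g \<Longrightarrow> fib_rec (\<lambda>i. c * g i)"
  by (simp add: fib_rec_def distrib_left)

lemma fib_rec_scale_right: "fib_rec g \<Longrightarrow> fib_rec (\<lambda>i. g i * c)"
  by (simp add: fib_rec_def distrib_right)

lemma fib_rec_shift: "fib_rec g \<Longrightarrow> fib_rec (\<lambda>i. g (c + i))"
  by (simp add: fib_rec_def add.assoc[symmetric])

lemma fib_rec_add: "fib_rec f \<Longrightarrow> fib_rec g \<Longrightarrow> fib_rec (\<lambda>i. f i + g i)"
  by (simp add: fib_rec_def algebra_simps)

lemma fib_rec_reflect:
  fixes g :: "int \<Rightarrow> real"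
  assumes "fib_rec g"
  shows "fib_rec (\<lambda>i. (- 1) powi i * g (c - i))"
  unfolding fib_rec_def
proof
  fix i
  have "g (c - i) = g (c - (i + 1)) + g (c - (i + 2))"
    using fib_recD[OF assms, of "c - (i + 2)"] by (simp add: algebra_simps)
  then show "(- 1) powi (i + 2) * g (c - (i + 2)) =
      (- 1) powi (i + 1) * g (c - (i + 1)) + (- 1) powi i * g (c - i)"
    by (simp add: power_int_add algebra_simps)
qed

lemma fibz_addition:
  fixes g :: "int \<Rightarrow> real"
  assumes g: "fib_rec g"
  shows "fibz (p + q) * g y = fibz p * g (y + q) + (- 1) powi p * fibz q * g (y - p)"
proof -
  note F = fib_rec_of_int[OF fib_rec_fibz, where 'a = real]
  have unit: "fibz (p + 1) * g y = fibz p * g (y + 1) + (- 1) powi p * g (y - p)" for p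
  proof -
    have "fibz (1 + p) * g y = fibz p * g (y + 1) + (- 1) powi p * g (y - p)"
    proof (rule fib_rec_eqI[of "\<lambda>p. fibz (1 + p) * g y"
          "\<lambda>p. fibz p * g (y + 1) + (- 1) powi p * g (y - p)"])
      show "fib_rec (\<lambda>p. fibz (1 + p) * g y)"
        by (intro fib_rec_scale_right fib_rec_shift[OF F])
      show "fib_rec (\<lambda>p. fibz p * g (y + 1) + (- 1) powi p * g (y - p))"
        by (intro fib_rec_add fib_rec_scale_right F fib_rec_reflect g)
      show "fibz (1 + 1) * g y = fibz 1 * g (y + 1) + (- 1) powi 1 * g (y - 1)"
        using fib_recD[OF g, of "y - 1"] fib_recD[OF fib_rec_fibz, of 0]
        by (simp add: algebra_simps)
    qed simp
    then show ?thesis by (simp add: add.commute)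
  qed
  show ?thesis
  proof (rule fib_rec_eqI[of "\<lambda>q. fibz (p + q) * g y"
        "\<lambda>q. fibz p * g (y + q) + (- 1) powi p * fibz q * g (y - p)"])
    show "fib_rec (\<lambda>q. fibz (p + q) * g y)"
      by (intro fib_rec_scale_right fib_rec_shift[OF F])
    show "fib_rec (\<lambda>q. fibz p * g (y + q) + (- 1) powi p * fibz q * g (y - p))"
      by (intro fib_rec_add fib_rec_scale fib_rec_scale_right fib_rec_shift F g)
  qed (simp_all add: unit)
qed

lemma telescoping_sum:
  fixes u h :: "nat \<Rightarrow> 'a::field"
  assumes "\<And>j. j \<le> Suc k \<Longrightarrow> u j \<noteq> 0"
    and "\<And>j. C * h j = A * u (Suc j) - B * u j"
  shows "C * (\<Sum>j=0..k. A ^ (k - j) * B ^ j * h j / (u (Suc j) * u j)) =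
    A ^ Suc k / u 0 - B ^ Suc k / u (Suc k)"
proof -
  have "C * (\<Sum>j=0..k. A ^ (k - j) * B ^ j * h j / (u (Suc j) * u j)) =
      (\<Sum>j=0..k. A ^ (Suc k - j) * B ^ j / u j - A ^ (Suc k - Suc j) * B ^ Suc j / u (Suc j))"
    unfolding sum_distrib_left
  proof (rule sum.cong[OF refl])
    fix j assume j: "j \<in> {0..k}"
    have "C * (A ^ (k - j) * B ^ j * h j / (u (Suc j) * u j)) =
        A ^ (k - j) * B ^ j * (C * h j) / (u (Suc j) * u j)"
      by simp
    also have "\<dots> = A ^ (Suc k - j) * B ^ j / u j - A ^ (Suc k - Suc j) * B ^ Suc j / u (Suc j)"
      using assms(1)[of j] assms(1)[of "Suc j"] j
      by (simp add: assms(2) Suc_diff_le field_simps)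
    finally show "C * (A ^ (k - j) * B ^ j * h j / (u (Suc j) * u j)) = \<dots>" .
  qed
  also have "\<dots> = A ^ Suc k / u 0 - B ^ Suc k / u (Suc k)"
    using sum_telescope[of "\<lambda>j. A ^ (Suc k - j) * B ^ j / u j" k]
    by (simp add: atMost_atLeast0)
  finally show ?thesis .
qed

lemma telescoping_sum_int:
  fixes g h :: "int \<Rightarrow> 'a::field"
  assumes nz: "\<forall>j\<in>{0..k}. g (n - d * int k + d * int j) \<noteq> 0 \<and>
      g (n - d - d * int k + d * int j) \<noteq> 0"
    and rel: "\<And>x. C * h x = A * g x - B * g (x - d)"
  shows "C * (g n * g (n - d * (int k + 1))) *
      (\<Sum>j=0..k. A ^ (k - j) * B ^ j * h (n - d * int k + d * int j) /
        (g (n - d * int k + d * int j) * g (n - d - d * int k + d * int j))) =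
    A ^ (k + 1) * g n - B ^ (k + 1) * g (n - d * (int k + 1))"
proof -
  define u where "u j = g (n - d - d * int k + d * int j)" for j
  have u_Suc: "g (n - d * int k + d * int j) = u (Suc j)" for j
    by (simp add: u_def algebra_simps)
  have u_0: "g (n - d * (int k + 1)) = u 0" and u_last: "g n = u (Suc k)"
    by (simp_all add: u_def algebra_simps)
  have u_nz: "u j \<noteq> 0" if "j \<le> Suc k" for j
  proof (cases j)
    case 0
    then show ?thesis using bspec[OF nz, of 0] by (simp add: u_def)
  next
    case (Suc i)
    then show ?thesis using nz that u_Suc[of i] by auto
  qed
  have "C * h (n - d * int k + d * int j) = A * u (Suc j) - B * u j" for j
    unfolding rel u_Suc by (simp add: u_def algebra_simps)
  from telescoping_sum[of k u C "\<lambda>j. h (n - d * int k + d * int j)", OF u_nz this]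
  have "C * (\<Sum>j=0..k. A ^ (k - j) * B ^ j * h (n - d * int k + d * int j) / (u (Suc j) * u j)) =
      A ^ Suc k / u 0 - B ^ Suc k / u (Suc k)" .
  then have "u (Suc k) * u 0 * (C * (\<Sum>j=0..k. A ^ (k - j) * B ^ j * h (n - d * int k + d * int j) /
        (u (Suc j) * u j))) = A ^ Suc k * u (Suc k) - B ^ Suc k * u 0"
    using u_nz[of 0] u_nz[of "Suc k"] by (simp add: field_simps)
  then show ?thesis
    unfolding u_Suc u_0 u_last u_def[symmetric] by (simp add: mult_ac)
qed

theorem theorem6:
  fixes G :: "int \<Rightarrow> int" and a b m n :: int and k :: nat
  assumes "fib_like G"
  shows
    "((\<forall>j\<in>{0..k}. G (n - (m - a) * int k + (m - a) * int j) \<noteq> 0 \<and>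
               G (n - (m - a) - (m - a) * int k + (m - a) * int j) \<noteq> 0) \<longrightarrow>
      (- 1) powi (a + b + 1) * real_of_int (fibz (m - a) * G n * G (n - (m - a) * (int k + 1))) *
        (\<Sum>j=0..k. real_of_int
            (fibz (a - b) ^ (k - j) * fibz (m - b) ^ j *
             G (n - m + b - (m - a) * int k + (m - a) * int j)) /
          real_of_int
            (G (n - (m - a) * int k + (m - a) * int j) *
             G (n - (m - a) - (m - a) * int k + (m - a) * int j)))
      = real_of_int (fibz (a - b) ^ (k + 1) * G n) -
        real_of_int (fibz (m - b) ^ (k + 1) * G (n - (m - a) * (int k + 1)))) \<and>
     ((\<forall>j\<in>{0..k}. G (n - (m - b) * int k + (m - b) * int j) \<noteq> 0 \<and>
               G (n - (m - b) - (m - b) * int k + (m - b) * int j) \<noteq> 0) \<longrightarrow>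
      real_of_int (fibz (m - b) * G n * G (n - (m - b) * (int k + 1))) *
        (\<Sum>j=0..k. (- 1) powi ((a + b + 1) * int j) * real_of_int
            (fibz (a - b) ^ (k - j) * fibz (m - a) ^ j *
             G (n - (m - a) - (m - b) * int k + (m - b) * int j)) /
          real_of_int
            (G (n - (m - b) * int k + (m - b) * int j) *
             G (n - (m - b) - (m - b) * int k + (m - b) * int j)))
      = real_of_int (fibz (a - b) ^ (k + 1) * G n) -
        (- 1) powi ((a + b + 1) * (int k + 1)) * real_of_int (fibz (m - a) ^ (k + 1) * G (n - (m - b) * (int k + 1)))) \<and>
     ((\<forall>j\<in>{0..k}. G (n - (a - b) * int k + (a - b) * int j) \<noteq> 0 \<and>
               G (n - (a - b) - (a - b) * int k + (a - b) * int j) \<noteq> 0) \<longrightarrow>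
      real_of_int (fibz (a - b) * G n * G (n - (a - b) * (int k + 1))) *
        (\<Sum>j=0..k. (- 1) powi ((a + b) * int j) * real_of_int
            (fibz (m - b) ^ (k - j) * fibz (m - a) ^ j *
             G (n + m - a - (a - b) * int k + (a - b) * int j)) /
          real_of_int
            (G (n - (a - b) * int k + (a - b) * int j) *
             G (n - (a - b) - (a - b) * int k + (a - b) * int j)))
      = real_of_int (fibz (m - b) ^ (k + 1) * G n) -
        (- 1) powi ((a + b) * (int k + 1)) * real_of_int (fibz (m - a) ^ (k + 1) * G (n - (a - b) * (int k + 1)))) \<and>
     ((\<forall>j\<in>{0..k}. G (n - (m + b) * int k + (m + b) * int j) \<noteq> 0 \<and>
               G (n - (m + b) - (m + b) * int k + (m + b) * int j) \<noteq> 0) \<longrightarrow>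
      (- 1) powi (a + b + 1) * real_of_int (fibz (m + b) * G n * G (n - (m + b) * (int k + 1))) *
        (\<Sum>j=0..k. real_of_int
            (fibz (a - b) ^ (k - j) * fibz (m + a) ^ j *
             G (n - m - a - (m + b) * int k + (m + b) * int j)) /
          real_of_int
            (G (n - (m + b) * int k + (m + b) * int j) *
             G (n - (m + b) - (m + b) * int k + (m + b) * int j)))
      = real_of_int (fibz (a - b) ^ (k + 1) * G n) -
        real_of_int (fibz (m + a) ^ (k + 1) * G (n - (m + b) * (int k + 1)))) \<and>
     ((\<forall>j\<in>{0..k}. G (n - (m + a) * int k + (m + a) * int j) \<noteq> 0 \<and>
               G (n - (m + a) - (m + a) * int k + (m + a) * int j) \<noteq> 0) \<longrightarrow>
      real_of_int (fibz (m + a) * G n * G (n - (m + a) * (int k + 1))) *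
        (\<Sum>j=0..k. (- 1) powi ((a + b + 1) * int j) * real_of_int
            (fibz (a - b) ^ (k - j) * fibz (m + b) ^ j *
             G (n - (m + b) - (m + a) * int k + (m + a) * int j)) /
          real_of_int
            (G (n - (m + a) * int k + (m + a) * int j) *
             G (n - (m + a) - (m + a) * int k + (m + a) * int j)))
      = real_of_int (fibz (a - b) ^ (k + 1) * G n) -
        (- 1) powi ((a + b + 1) * (int k + 1)) * real_of_int (fibz (m + b) ^ (k + 1) * G (n - (m + a) * (int k + 1)))) \<and>
     ((\<forall>j\<in>{0..k}. G (n - (a - b) * int k + (a - b) * int j) \<noteq> 0 \<and>
               G (n - (a - b) - (a - b) * int k + (a - b) * int j) \<noteq> 0) \<longrightarrow>
      real_of_int (fibz (a - b) * G n * G (n - (a - b) * (int k + 1))) *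
        (\<Sum>j=0..k. (- 1) powi ((a + b) * int j) * real_of_int
            (fibz (m + a) ^ (k - j) * fibz (m + b) ^ j *
             G (n + m + b - (a - b) * int k + (a - b) * int j)) /
          real_of_int
            (G (n - (a - b) * int k + (a - b) * int j) *
             G (n - (a - b) - (a - b) * int k + (a - b) * int j)))
      = real_of_int (fibz (m + a) ^ (k + 1) * G n) -
        (- 1) powi ((a + b) * (int k + 1)) * real_of_int (fibz (m + b) ^ (k + 1) * G (n - (a - b) * (int k + 1))))"
proof -
  define g where "g i = real_of_int (G i)" for i
  define p where "p = a - b"
  have g: "fib_rec g"
    unfolding g_def by (intro fib_rec_of_int fib_rec_fib_like assms)
  have sgn: "(- 1 :: real) powi p = (- 1) powi (a + b)"
    "(- 1 :: real) powi (a + b + 1) = - ((- 1) powi (a + b))"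
    by (simp_all add: p_def power_int_minus_left power_int_add)
  have sgn_pow: "(- 1 :: real) powi (c * int j) = ((- 1) powi c) ^ j" for c j
    by (simp add: power_int_mult)
  have sgn_pow_Suc: "(- 1 :: real) powi (c * (int k + 1)) = ((- 1) powi c) ^ (k + 1)" for c
    using sgn_pow[of c "k + 1"] by (simp add: add.commute)
  note pow = sgn_pow sgn_pow_Suc power_mult_distrib
  have rel1: "((- 1) powi (a + b + 1) * fibz q) * g (x - q - p) =
      fibz p * g x - fibz (p + q) * g (x - q)" for q x
    using fibz_addition[OF g, of p q "x - q"] by (simp add: sgn)
  have rel2: "fibz (p + q) * g (x - q) =
      fibz p * g x - ((- 1) powi (a + b + 1) * fibz q) * g (x - (p + q))" for q x
    using fibz_addition[OF g, of p q "x - q"] by (simp add: sgn diff_diff_add add.commute[of q p])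
  have rel3: "fibz p * g (x + q) =
      fibz (p + q) * g x - ((- 1) powi (a + b) * fibz q) * g (x - p)" for q x
    using fibz_addition[OF g, of p q x] by (simp add: sgn)
  have nz: "g i \<noteq> 0 \<longleftrightarrow> G i \<noteq> 0" for i
    by (simp add: g_def)
  show ?thesis
    unfolding of_int_mult of_int_power g_def[symmetric] nz[symmetric] pow
  proof (intro conjI impI, goal_cases)
    case 1
    have "(- 1) powi (a + b + 1) * fibz (m - a) * g (x - m + b) =
        fibz (a - b) * g x - fibz (m - b) * g (x - (m - a))" for x
      using rel1[where q = "m - a" and x = x] by (simp add: p_def algebra_simps)
    from telescoping_sum_int[where h = "\<lambda>x. g (x - m + b)", OF 1 this]
    show ?case
      by (simp add: power_mult_distrib algebra_simps)
  next
    case 2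
    have "fibz (m - b) * g (x - (m - a)) =
        fibz (a - b) * g x - (- 1) powi (a + b + 1) * fibz (m - a) * g (x - (m - b))" for x
      using rel2[where q = "m - a" and x = x] by (simp add: p_def algebra_simps)
    from telescoping_sum_int[where h = "\<lambda>x. g (x - (m - a))", OF 2 this]
    show ?case
      by (simp add: power_mult_distrib algebra_simps)
  next
    case 3
    have "fibz (a - b) * g (x + m - a) =
        fibz (m - b) * g x - (- 1) powi (a + b) * fibz (m - a) * g (x - (a - b))" for x
      using rel3[where q = "m - a" and x = x] by (simp add: p_def algebra_simps)
    from telescoping_sum_int[where h = "\<lambda>x. g (x + m - a)", OF 3 this]
    show ?case
      by (simp add: power_mult_distrib algebra_simps)
  next
    case 4
    have "(- 1) powi (a + b + 1) * fibz (m + b) * g (x - m - a) =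
        fibz (a - b) * g x - fibz (m + a) * g (x - (m + b))" for x
      using rel1[where q = "m + b" and x = x] by (simp add: p_def algebra_simps)
    from telescoping_sum_int[where h = "\<lambda>x. g (x - m - a)", OF 4 this]
    show ?case
      by (simp add: power_mult_distrib algebra_simps)
  next
    case 5
    have "fibz (m + a) * g (x - (m + b)) =
        fibz (a - b) * g x - (- 1) powi (a + b + 1) * fibz (m + b) * g (x - (m + a))" for x
      using rel2[where q = "m + b" and x = x] by (simp add: p_def algebra_simps)
    from telescoping_sum_int[where h = "\<lambda>x. g (x - (m + b))", OF 5 this]
    show ?case
      by (simp add: power_mult_distrib algebra_simps)
  next
    case 6
    have "fibz (a - b) * g (x + m + b) =
        fibz (m + a) * g x - (- 1) powi (a + b) * fibz (m + b) * g (x - (a - b))" for x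
      using rel3[where q = "m + b" and x = x] by (simp add: p_def algebra_simps)
    from telescoping_sum_int[where h = "\<lambda>x. g (x + m + b)", OF 6 this]
    show ?case
      by (simp add: power_mult_distrib algebra_simps)
  qed
qed

end
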